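(* Let $m\geq 1$ be an integer, let $\boldsymbol{r}_{j}=(r_{1j},r_{2j})^{T}\in\mathbb{R}^{2}$ be given points and let $w_{j}\in\mathbb{R}$ for $j=1,\ldots,m$, and let $s,t\in\mathbb{R}$ with $s\leq t$. Consider the problem of finding all $(x_{1},x_{2})^{T}\in\mathbb{R}^{2}$ that $$ \text{minimize}\quad \max_{1\leq j\leq m}(|x_{1}-r_{1j}|+|x_{2}-r_{2j}|+w_{j})\qquad\text{subject to}\quad s\leq x_{1}\leq t. $$ Define \begin{align*} p_{1}&=\max_{1\leq j\leq m}(w_{j}+r_{1j}+r_{2j}), & p_{2}&=\max_{1\leq j\leq m}(w_{j}-r_{1j}+r_{2j}),\\ q_{1}&=\min_{1\leq j\leq m}(-w_{j}+r_{1j}+r_{2j}), & q_{2}&=\min_{1\leq j\leq m}(-w_{j}-r_{1j}+r_{2j}). \end{align*} Then the minimum value in the problem is equal to $$ \theta=\max(p_{1}-q_{1},\ p_{1}-q_{2}-2t,\ p_{2}-q_{1}+2s,\ p_{2}-q_{2})/2, $$ and all solutions (i.e. exactly the set of minimizers) are given by \begin{align*} x_{1}&=\max(u_{1},u_{2}+2s)/2-\max(u_{1}-2t,u_{2})/2,\\ x_{2}&=\max(u_{1},u_{2}+2s)/2+\max(u_{1}-2t,u_{2})/2, \end{align*} where \begin{align*} u_{1}&=(1-\alpha)(p_{1}-\theta)+\alpha(\min(q_{1},q_{2}+2t)+\theta),\\ u_{2}&=(1-\alpha)(p_{2}-\theta)+\alpha(\min(q_{1}-2s,q_{2})+\theta)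 \end{align*} for all real $\alpha$ such that $0\leq\alpha\leq 1$.
   Context: All operations are in conventional real arithmetic. "Solutions" of the problem are the feasible points at which the minimum of the objective function over the feasible set is attained; the same parameter $\alpha$ is used in both $u_{1}$ and $u_{2}$, and the solution set is obtained as $\alpha$ ranges over $[0,1]$. *)

theory Defs
  imports "HOL-Analysis.Analysis"
begin

definition location_objective ::
  "nat \<Rightarrow> (nat \<Rightarrow> real ^ 2) \<Rightarrow> (nat \<Rightarrow> real) \<Rightarrow> real ^ 2 \<Rightarrow> real" where
  "location_objective m r w x =
     Max ((\<lambda>j. \<bar>x $ 1 - r j $ 1\<bar> + \<bar>x $ 2 - r j $ 2\<bar> + w j) ` {1..m})"

definition vertical_strip :: "real \<Rightarrow> real \<Rightarrow> (real ^ 2) set" where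
  "vertical_strip s t = {x. s \<le> x $ 1 \<and> x $ 1 \<le> t}"

end

(* In the coordinates y1 = x1 + x2, y2 = x2 - x1 the sublevel set {objective <= v} is the box
   [p1 - v, q1 + v] x [p2 - v, q2 + v], and the constraint is the strip 2 s <= y1 - y2 <= 2 t.
   The value theta is the least v for which box and strip meet. The points of the strip in the box
   for theta are the images of the box L <= u <= U under
   (u1, u2) |-> (max u1 (u2 + 2 s), max (u1 - 2 t) u2), where L and U are the endpoints for
   alpha = 0 and alpha = 1. By the choice of theta, L and U agree in some coordinate,
   so the box for u is a segment and a single parameter alpha suffices. *)
theory Submission
  imports Defs
begin

text \<open>A sum \<open>\<bar>a\<bar> + \<bar>b\<bar>\<close> is bounded by \<open>c\<close> iff
  all four signed sums of \<open>a\<close> and \<open>b\<close> are. The points \<open>r j\<close>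
  and weights \<open>w j\<close> then separate from \<open>x\<close>, so the conditions over all
  \<open>j\<close> collapse into one maximum or minimum per sign pattern.\<close>

lemma location_objective_le_iff:
  assumes "m \<ge> 1"
  shows "location_objective m r w x \<le> v \<longleftrightarrow>
    Max ((\<lambda>j. w j + r j $ 1 + r j $ 2) ` {1..m}) - v \<le> x $ 1 + x $ 2 \<and>
    x $ 1 + x $ 2 \<le> Min ((\<lambda>j. - w j + r j $ 1 + r j $ 2) ` {1..m}) + v \<and>
    Max ((\<lambda>j. w j - r j $ 1 + r j $ 2) ` {1..m}) - v \<le> x $ 2 - x $ 1 \<and>
    x $ 2 - x $ 1 \<le> Min ((\<lambda>j. - w j - r j $ 1 + r j $ 2) ` {1..m}) + v"
proof -
  have Max_le: "Max (f ` {1..m}) \<le> c \<longleftrightarrow> (\<forall>j\<in>{1..m}. f j \<le> c)" for f :: "nat \<Rightarrow> real" and c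
    using assms by (subst Max_le_iff) auto
  have le_Min: "c \<le> Min (f ` {1..m}) \<longleftrightarrow> (\<forall>j\<in>{1..m}. c \<le> f j)" for f :: "nat \<Rightarrow> real" and c
    using assms by (subst Min_ge_iff) auto
  have abs_sum: "\<bar>a - b\<bar> + \<bar>c - d\<bar> + e \<le> v \<longleftrightarrow>
      e + b + d \<le> a + c + v \<and> a + c - v \<le> - e + b + d \<and>
      e - b + d \<le> c - a + v \<and> c - a - v \<le> - e - b + d" for a b c d e :: real
    by linarith
  have "location_objective m r w x \<le> v \<longleftrightarrow>
      (\<forall>j\<in>{1..m}. w j + r j $ 1 + r j $ 2 \<le> x $ 1 + x $ 2 + v) \<and>
      (\<forall>j\<in>{1..m}. x $ 1 + x $ 2 - v \<le> - w j + r j $ 1 + r j $ 2) \<and>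
      (\<forall>j\<in>{1..m}. w j - r j $ 1 + r j $ 2 \<le> x $ 2 - x $ 1 + v) \<and>
      (\<forall>j\<in>{1..m}. x $ 2 - x $ 1 - v \<le> - w j - r j $ 1 + r j $ 2)"
    unfolding location_objective_def Max_le abs_sum by blast
  then show ?thesis
    unfolding Max_le[symmetric] le_Min[symmetric] by linarith
qed

lemma affine_combination_between:
  fixes l u a :: real
  assumes "l \<le> u" and "0 \<le> a" and "a \<le> 1"
  shows "l \<le> (1 - a) * l + a * u" and "(1 - a) * l + a * u \<le> u"
proof -
  have "0 \<le> a * (u - l)" and "0 \<le> (1 - a) * (u - l)"
    using assms by simp_all
  then show "l \<le> (1 - a) * l + a * u" and "(1 - a) * l + a * u \<le> u"
    by (simp_all add: algebra_simps)
qed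

lemma affine_combination_obtain:
  fixes l u y :: real
  assumes "l \<le> y" and "y \<le> u"
  obtains a where "0 \<le> a" and "a \<le> 1" and "y = (1 - a) * l + a * u"
proof -
  have "y \<in> closed_segment l u"
    using assms by (simp add: closed_segment_eq_real_ivl)
  then show thesis
    using that by (auto simp: in_segment)
qed

theorem corollary7:
  fixes m :: nat
    and r :: "nat \<Rightarrow> real ^ 2"
    and w :: "nat \<Rightarrow> real"
    and s t p1 p2 q1 q2 \<theta> :: real
    and u1 u2 x1 x2 :: "real \<Rightarrow> real"
  assumes "m \<ge> 1"
    and "s \<le> t"
    and "p1 = Max ((\<lambda>j. w j + r j $ 1 + r j $ 2) ` {1..m})"
    and "p2 = Max ((\<lambda>j. w j - r j $ 1 + r j $ 2) ` {1..m})"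
    and "q1 = Min ((\<lambda>j. - w j + r j $ 1 + r j $ 2) ` {1..m})"
    and "q2 = Min ((\<lambda>j. - w j - r j $ 1 + r j $ 2) ` {1..m})"
    and "\<theta> = Max {p1 - q1, p1 - q2 - 2 * t, p2 - q1 + 2 * s, p2 - q2} / 2"
    and "\<And>\<alpha>. u1 \<alpha> = (1 - \<alpha>) * (p1 - \<theta>) + \<alpha> * (min q1 (q2 + 2 * t) + \<theta>)"
    and "\<And>\<alpha>. u2 \<alpha> = (1 - \<alpha>) * (p2 - \<theta>) + \<alpha> * (min (q1 - 2 * s) q2 + \<theta>)"
    and "\<And>\<alpha>. x1 \<alpha> = max (u1 \<alpha>) (u2 \<alpha> + 2 * s) / 2 - max (u1 \<alpha> - 2 * t) (u2 \<alpha>) / 2"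
    and "\<And>\<alpha>. x2 \<alpha> = max (u1 \<alpha>) (u2 \<alpha> + 2 * s) / 2 + max (u1 \<alpha> - 2 * t) (u2 \<alpha>) / 2"
  shows "(\<exists>x \<in> vertical_strip s t. location_objective m r w x = \<theta>) \<and>
         (\<forall>x \<in> vertical_strip s t. \<theta> \<le> location_objective m r w x) \<and>
         {x. is_arg_min (location_objective m r w) (\<lambda>x. x \<in> vertical_strip s t) x} =
         {vector [x1 \<alpha>, x2 \<alpha>] | \<alpha>. 0 \<le> \<alpha> \<and> \<alpha> \<le> 1}"
proof -
  let ?S = "{x \<in> vertical_strip s t. location_objective m r w x \<le> \<theta>}"
  \<comment> \<open>Besides \<open>y1 \<le> q1 + \<theta>\<close>, the strip gives
    \<open>y1 \<le> y2 + 2 * t \<le> q2 + \<theta> + 2 * t\<close>; \<open>U1\<close> is the smaller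
    bound. \<open>U2\<close> bounds \<open>y2\<close> likewise.\<close>
  define U1 U2 where "U1 = min q1 (q2 + 2 * t) + \<theta>" and "U2 = min (q1 - 2 * s) q2 + \<theta>"
  have le_iff: "location_objective m r w x \<le> v \<longleftrightarrow>
      p1 - v \<le> x $ 1 + x $ 2 \<and> x $ 1 + x $ 2 \<le> q1 + v \<and>
      p2 - v \<le> x $ 2 - x $ 1 \<and> x $ 2 - x $ 1 \<le> q2 + v" for x v
    using location_objective_le_iff[OF assms(1)] assms(3-6) by blast
  have theta: "2 * \<theta> = max (p1 - q1) (max (p1 - q2 - 2 * t) (max (p2 - q1 + 2 * s) (p2 - q2)))"
    using assms(7) by simp
  have u: "u1 \<alpha> = (1 - \<alpha>) * (p1 - \<theta>) + \<alpha> * U1" "u2 \<alpha> = (1 - \<alpha>) * (p2 - \<theta>) + \<alpha> * U2" for \<alpha>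
    using assms(8,9) by (simp_all add: U1_def U2_def)
  from theta have theta_ge: "p1 - q1 \<le> 2 * \<theta>" "p1 - q2 - 2 * t \<le> 2 * \<theta>"
      "p2 - q1 + 2 * s \<le> 2 * \<theta>" "p2 - q2 \<le> 2 * \<theta>"
    by simp_all
  from theta have theta_cases: "2 * \<theta> = p1 - q1 \<or> 2 * \<theta> = p1 - q2 - 2 * t \<or>
      2 * \<theta> = p2 - q1 + 2 * s \<or> 2 * \<theta> = p2 - q2"
    by (simp add: max_def split: if_splits)
  \<comment> \<open>The first two entries of the maximum defining \<theta> compare
    \<open>p1 - \<theta>\<close> with the two terms of \<open>U1\<close>, the last two
    \<open>p2 - \<theta>\<close> with those of \<open>U2\<close>. An entry attaining the maximum
    yields an equality.\<close>
  have U_ge: "p1 - \<theta> \<le> U1" "p2 - \<theta> \<le> U2"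
    using theta_ge unfolding U1_def U2_def by linarith+
  have U_eq: "p1 - \<theta> = U1 \<or> p2 - \<theta> = U2"
    using theta_ge theta_cases unfolding U1_def U2_def by linarith
  \<comment> \<open>With \<open>v\<close> the objective value at \<open>x\<close>, chaining the
    lower and upper bounds, within one coordinate or across both by the strip, bounds each entry by
    \<open>2 * v\<close>.\<close>
  have lower: "\<theta> \<le> location_objective m r w x" if "x \<in> vertical_strip s t" for x
    using le_iff[of x "location_objective m r w x"] that theta_cases
    unfolding vertical_strip_def mem_Collect_eq by linarith
  have sol: "vector [x1 \<alpha>, x2 \<alpha>] \<in> ?S" if "0 \<le> \<alpha>" "\<alpha> \<le> 1" for \<alpha>
  proof -
    have "p1 - \<theta> \<le> u1 \<alpha>" "u1 \<alpha> \<le> U1" "p2 - \<theta> \<le> u2 \<alpha>" "u2 \<alpha> \<le> U2"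
      unfolding u using affine_combination_between U_ge that by blast+
    moreover have "x1 \<alpha> + x2 \<alpha> = max (u1 \<alpha>) (u2 \<alpha> + 2 * s)"
      "x2 \<alpha> - x1 \<alpha> = max (u1 \<alpha> - 2 * t) (u2 \<alpha>)"
      using assms(10,11)[of \<alpha>] by simp_all
    moreover have "U1 \<le> q1 + \<theta>" "U1 \<le> q2 + 2 * t + \<theta>" "U2 \<le> q1 - 2 * s + \<theta>" "U2 \<le> q2 + \<theta>"
      unfolding U1_def U2_def by simp_all
    \<comment> \<open>As \<open>s \<le> t\<close>, the pair of maxima raises at most one coordinate
      of \<open>(u1, u2)\<close>, just enough to reach the strip.\<close>
    ultimately show ?thesis
      using assms(2) unfolding mem_Collect_eq le_iff vertical_strip_def vector_2
      by (auto simp: max_def split: if_splits)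
  qed
  have param: "\<exists>\<alpha>. x = vector [x1 \<alpha>, x2 \<alpha>] \<and> 0 \<le> \<alpha> \<and> \<alpha> \<le> 1" if "x \<in> ?S" for x
  proof -
    define y1 y2 where "y1 = x $ 1 + x $ 2" and "y2 = x $ 2 - x $ 1"
    have strip: "y2 + 2 * s \<le> y1" "y1 - 2 * t \<le> y2"
      using that unfolding vertical_strip_def y1_def y2_def by simp_all
    have box: "p1 - \<theta> \<le> y1" "y1 \<le> U1" "p2 - \<theta> \<le> y2" "y2 \<le> U2"
      using that strip le_iff[of x \<theta>] unfolding U1_def U2_def y1_def y2_def by auto
    \<comment> \<open>The coordinate whose bounds coincide is constant in \<alpha> and equals that
      of \<open>x\<close>; the other one determines a suitable \<alpha>.\<close>
    obtain \<alpha> where \<alpha>: "0 \<le> \<alpha>" "\<alpha> \<le> 1" and "u1 \<alpha> = y1" and "u2 \<alpha> = y2"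
      using U_eq
    proof
      assume "p1 - \<theta> = U1"
      then have "u1 \<alpha> = y1" for \<alpha>
        using box by (simp add: u algebra_simps)
      with affine_combination_obtain[OF box(3,4)] that show thesis
        by (metis u(2))
    next
      assume "p2 - \<theta> = U2"
      then have "u2 \<alpha> = y2" for \<alpha>
        using box by (simp add: u algebra_simps)
      with affine_combination_obtain[OF box(1,2)] that show thesis
        by (metis u(1))
    qed
    \<comment> \<open>Inside the strip the maxima return \<open>y1\<close> and \<open>y2\<close>
      unchanged.\<close>
    then have "x1 \<alpha> = x $ 1" "x2 \<alpha> = x $ 2"
      using strip by (simp_all add: assms(10,11) max_absorb1 max_absorb2 y1_def y2_def field_simps)
    then show ?thesis
      using \<alpha> by (intro exI[of _ \<alpha>]) (simp add: vec_eq_iff forall_2)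
  qed
  have attained: "\<exists>x \<in> vertical_strip s t. location_objective m r w x = \<theta>"
    using sol[of 0] lower by (force intro: antisym)
  then have "{x. is_arg_min (location_objective m r w) (\<lambda>x. x \<in> vertical_strip s t) x} = ?S"
    using lower by (fastforce simp: is_arg_min_linorder)
  also have "\<dots> = {vector [x1 \<alpha>, x2 \<alpha>] | \<alpha>. 0 \<le> \<alpha> \<and> \<alpha> \<le> 1}"
    using sol param by blast
  finally show ?thesis
    using attained lower by blast
qed

end
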